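(* Let $g$ be a derivator, $\mathbb F\in\{\mathbb R,\mathbb C\}$, $a<b$ real numbers and $n\in\mathbb N$. For every uniformly $g$-continuous function $f:[a,b]\to\mathbb F$ there exists a unique $p\in\operatorname{P}_n$ (uniqueness being understood for functions on $[a,b]$) such that $$\|f-p\|_\infty=\inf_{q\in\operatorname{P}_n}\|f-q\|_\infty,$$ where $\|\cdot\|_\infty$ is the supremum norm on $[a,b]$.
   Context: $\mathbb N=\{0,1,2,\dots\}$. A derivator is a left-continuous nondecreasing function $g:\mathbb R\to\mathbb R$; $\mu_g$ is the Lebesgue–Stieltjes measure with $\mu_g([c,d))=g(d)-g(c)$. A function $f:[a,b]\to\mathbb F$ is uniformly $g$-continuous if for every $\varepsilon>0$ there is $\delta>0$ such that $|f(x)-f(y)|<\varepsilon$ for all $x,y\in[a,b]$ with $|g(x)-g(y)|<\delta$. Put $\int_x^y f\,d\mu_g=\int_{[x,y)}f\,d\mu_g$ if $y\ge x$ and $-\int_{[y,x)}f\,d\mu_g$ if $y<x$. For $x_0\in\mathbb R$ the $g$-monomials (Stieltjes monomials) are $g_{x_0,0}(x)=1$ and $g_{x_0,n}(x)=n\int_{x_0}^x g_{x_0,n-1}\,d\mu_g$ for $n\ge1$, $x\in\mathbb R$. $\operatorname{P}_n$ is the $\mathbb F$-vector space spanned by $g_{x_0,0},\dots,g_{x_0,n}$ (independent of $x_0$), here viewed as a space of functions on $[a,b]$ by restriction. *)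

theory Defs
  imports "HOL-Analysis.Analysis"
begin

definition derivator :: "(real \<Rightarrow> real) \<Rightarrow> bool" where
  "derivator g \<longleftrightarrow> mono g \<and> (\<forall>x. continuous (at_left x) g)"

(* Counterpart of interval_measure, which is based on right-continuous functions
   and intervals open on the left. *)
definition stieltjes_measure :: "(real \<Rightarrow> real) \<Rightarrow> real measure" where
  "stieltjes_measure g =
     extend_measure UNIV {(c, d). c \<le> d} (\<lambda>(c, d). {c..<d}) (\<lambda>(c, d). ennreal (g d - g c))"

lemma space_stieltjes_measure [simp]: "space (stieltjes_measure g) = UNIV"
  by (simp add: stieltjes_measure_def space_extend_measure)

lemma sets_stieltjes_measure [simp, measurable_cong]: "sets (stieltjes_measure g) = sets borel"
proof -
  let ?G = "(\<lambda>(c, d). {c..<d}) ` {(c, d). (c::real) \<le> d}"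
  have "sets (stieltjes_measure g) = sigma_sets UNIV ?G"
    by (simp add: stieltjes_measure_def sets_extend_measure)
  also have "\<dots> = sets borel"
  proof
    show "sigma_sets UNIV ?G \<subseteq> sets borel"
    proof -
      have "?G \<subseteq> sets borel" by auto
      from sets.sigma_sets_subset[OF this] show ?thesis by simp
    qed
    have *: "{c..} \<in> sigma_sets UNIV ?G" for c :: real
    proof -
      have "{c..} = (\<Union>n. {c..<c + real n})"
      proof
        show "{c..} \<subseteq> (\<Union>n. {c..<c + real n})"
        proof
          fix x assume x: "x \<in> {c..}"
          obtain n where "x - c < real n" using reals_Archimedean2 by blast
          with x show "x \<in> (\<Union>n. {c..<c + real n})"
            by (auto intro!: exI[of _ n])
        qed
      qed auto
      also have "\<dots> \<in> sigma_sets UNIV ?G"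
        by (intro sigma_sets.Union sigma_sets.Basic) (auto intro!: image_eqI[of _ _ "(c, c + real n)" for n])
      finally show ?thesis .
    qed
    have "sets (borel :: real measure) = sigma_sets UNIV (range (\<lambda>c. {c..}))"
      by (subst borel_Ici) simp
    also have "\<dots> \<subseteq> sigma_sets UNIV ?G"
      using * by (intro sigma_sets_mono) auto
    finally show "sets borel \<subseteq> sigma_sets UNIV ?G" .
  qed
  finally show ?thesis .
qed

lemma emeasure_stieltjes_measure_Ico:
  assumes "derivator g" "c \<le> d"
  shows "emeasure (stieltjes_measure g) {c..<d} = ennreal (g d - g c)"
proof -
  define F where "F t = - g (- t)" for t
  define N where "N = distr (interval_measure F) borel uminus"
  have mono_F: "F x \<le> F y" if "x \<le> y" for x y
    using that assms(1) by (auto simp: F_def derivator_def mono_def)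
  have cont_F: "continuous (at_right t) F" for t
  proof -
    have "(g \<longlongrightarrow> g (- t)) (at_left (- t))"
      using assms(1) by (simp add: derivator_def continuous_within)
    then have "((\<lambda>s. g (- s)) \<longlongrightarrow> g (- t)) (at_right t)"
      by (simp add: at_left_minus filterlim_filtermap)
    then show ?thesis
      unfolding continuous_within F_def by (rule tendsto_minus)
  qed
  have N_Ico: "emeasure N {c'..<d'} = ennreal (g d' - g c')" if "c' \<le> d'" for c' d'
  proof -
    have "emeasure N {c'..<d'} = emeasure (interval_measure F) (uminus -` {c'..<d'})"
      by (simp add: N_def emeasure_distr)
    also have "uminus -` {c'..<d'} = {- d'<..- c'}" by auto
    also have "emeasure (interval_measure F) \<dots> = F (- c') - F (- d')"
      using that by (intro emeasure_interval_measure_Ioc mono_F cont_F) auto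
    finally show ?thesis by (simp add: F_def)
  qed
  have sets_N: "sets (stieltjes_measure g) = sets N" by (simp add: N_def)
  show ?thesis
  proof (rule emeasure_extend_measure_Pair[OF stieltjes_measure_def, where \<mu>' = "emeasure N"])
    show "positive (sets (stieltjes_measure g)) (emeasure N)"
      unfolding sets_N by (rule emeasure_positive)
    show "countably_additive (sets (stieltjes_measure g)) (emeasure N)"
      unfolding sets_N by (rule emeasure_countably_additive)
  qed (use N_Ico assms(2) in auto)
qed

definition stieltjes_integral :: "(real \<Rightarrow> real) \<Rightarrow> real \<Rightarrow> real \<Rightarrow> (real \<Rightarrow> real) \<Rightarrow> real" where
  "stieltjes_integral g x y f =
     (if x \<le> y then LINT t:{x..<y}|stieltjes_measure g. f t
      else - (LINT t:{y..<x}|stieltjes_measure g. f t))"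

primrec stieltjes_monomial :: "(real \<Rightarrow> real) \<Rightarrow> real \<Rightarrow> nat \<Rightarrow> real \<Rightarrow> real" where
  "stieltjes_monomial g x0 0 = (\<lambda>x. 1)"
| "stieltjes_monomial g x0 (Suc n) =
     (\<lambda>x. real (Suc n) * stieltjes_integral g x0 x (stieltjes_monomial g x0 n))"

(* The span, over the scalar field 'a, of the first n + 1 monomials based at x0, as a space of
   functions on {a..b}: restrict makes each member undefined outside {a..b}, so that equality
   of members is equality on {a..b}. *)
definition stieltjes_polynomials ::
  "(real \<Rightarrow> real) \<Rightarrow> real \<Rightarrow> nat \<Rightarrow> real \<Rightarrow> real \<Rightarrow> (real \<Rightarrow> 'a::real_normed_field) set" where
  "stieltjes_polynomials g x0 n a b =
     {restrict (\<lambda>x. \<Sum>k\<le>n. c k * of_real (stieltjes_monomial g x0 k x)) {a..b} | c. True}"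

definition uniformly_g_continuous ::
  "(real \<Rightarrow> real) \<Rightarrow> real \<Rightarrow> real \<Rightarrow> (real \<Rightarrow> 'a::real_normed_field) \<Rightarrow> bool" where
  "uniformly_g_continuous g a b f \<longleftrightarrow>
     (\<forall>\<epsilon>>0. \<exists>\<delta>>0. \<forall>x\<in>{a..b}. \<forall>y\<in>{a..b}. \<bar>g x - g y\<bar> < \<delta> \<longrightarrow> norm (f x - f y) < \<epsilon>)"

definition sup_norm :: "real \<Rightarrow> real \<Rightarrow> (real \<Rightarrow> 'a::real_normed_field) \<Rightarrow> real" where
  "sup_norm a b f = (SUP x\<in>{a..b}. norm (f x))"

end

theory Submission
  imports Defs
begin

text \<open>Through the generalised inverse of \<open>g\<close>, every Stieltjes monomial becomes \<open>\<phi> \<circ> g\<close>, where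
  \<open>\<phi>\<close> is a continuous function on the line obtained by iterated Lebesgue integration along the step-like
  function \<open>\<gamma> = g \<circ> g\<^sup>-\<^sup>1\<close>. A uniformly \<open>g\<close>-continuous \<open>f\<close> likewise factors through a continuous function on
  the compact set \<open>K\<close>, the closure of \<open>g[a,b]\<close>; passing to \<open>K\<close> makes the suprema attained even
  when they are only approached at a jump of \<open>g\<close>.

  On \<open>K\<close> the \<open>\<phi>\<close>s form a Haar system. Zeros alone cannot be counted by Rolle's theorem, because
  jumps let a function change sign without a zero. Instead, a combination of order \<open>n\<close> that
  alternates weakly in sign at \<open>n + 2\<close> points of \<open>K\<close> vanishes: each increment is the integral of the
  derivative, which therefore alternates weakly at \<open>n + 1\<close> points. The bound on the number of zeros
  follows from this, and existence and uniqueness of best approximations from Haar's argument.\<close>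

section \<open>Linear algebra of generalised polynomials\<close>

definition combination :: "(nat \<Rightarrow> real \<Rightarrow> real) \<Rightarrow> nat \<Rightarrow> (nat \<Rightarrow> 'a::real_normed_field) \<Rightarrow> real \<Rightarrow> 'a" where
  "combination \<phi> n c u = (\<Sum>k\<le>n. c k * of_real (\<phi> k u))"

lemma combination_add:
  "combination \<phi> n (\<lambda>k. c k + d k) u = combination \<phi> n c u + combination \<phi> n d u"
  by (simp add: combination_def algebra_simps sum.distrib)

lemma combination_diff:
  "combination \<phi> n (\<lambda>k. c k - d k) u = combination \<phi> n c u - combination \<phi> n d u"
  by (simp add: combination_def algebra_simps sum_subtractf)

lemma combination_mult:
  "combination \<phi> n (\<lambda>k. t * c k) u = t * combination \<phi> n c u"
  by (simp add: combination_def sum_distrib_left mult_ac)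

lemma combination_sum:
  "combination \<phi> n (\<lambda>k. \<Sum>y\<in>S. t y * c y k) u = (\<Sum>y\<in>S. t y * combination \<phi> n (c y) u)"
  by (simp add: combination_def sum_distrib_left sum_distrib_right mult_ac) (rule sum.swap)

lemma combination_cong:
  "(\<And>k. k \<le> n \<Longrightarrow> c k = d k) \<Longrightarrow> combination \<phi> n c u = combination \<phi> n d u"
  by (simp add: combination_def)

lemma combination_truncate:
  assumes "m \<le> n" "\<And>k. m < k \<Longrightarrow> c k = 0"
  shows "combination \<phi> n c u = combination \<phi> m c u"
  unfolding combination_def using assms by (intro sum.mono_neutral_right) auto

text \<open>Holds because the basis functions are real-valued. It reduces complex coefficients to
  real ones, one coordinate at a time.\<close>

lemma inner_combination:
  fixes c :: "nat \<Rightarrow> 'a::{real_normed_field, euclidean_space}"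
  shows "combination \<phi> n c u \<bullet> b = combination \<phi> n (\<lambda>k. c k \<bullet> b) u"
  by (simp add: combination_def inner_sum_left mult.commute[of _ "of_real _"]
        mult.commute[of "_ \<bullet> _"] flip: scaleR_conv_of_real)

lemma continuous_on_combination:
  "(\<And>k. continuous_on K (\<phi> k)) \<Longrightarrow> continuous_on K (combination \<phi> n c)"
  unfolding combination_def by (intro continuous_intros)

section \<open>Zeros of systems with a Rolle property\<close>

text \<open>The coefficients \<open>real (Suc k) * c (Suc k)\<close> are those of a derivative, as
  for powers, and \<open>rolle\<close> is a one-sided mean value theorem. The point \<open>z\<close>
  may equal \<open>u\<close> but not \<open>v\<close>, matching Stieltjes integrals over half-open
  intervals; points picked in consecutive gaps are thus strictly increasing.\<close>

locale rolle_system =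
  fixes \<phi> :: "nat \<Rightarrow> real \<Rightarrow> real" and K :: "real set"
  assumes basis_0: "u \<in> K \<Longrightarrow> \<phi> 0 u = 1"
    and rolle: "\<lbrakk>u \<in> K; v \<in> K; u < v; combination \<phi> (Suc n) c u \<le> combination \<phi> (Suc n) c v\<rbrakk>
      \<Longrightarrow> \<exists>z\<in>K. u \<le> z \<and> z < v \<and> 0 \<le> combination \<phi> n (\<lambda>k. real (Suc k) * c (Suc k)) z"
begin

text \<open>Applies \<open>rolle\<close> to the coefficients \<open>t * c k\<close>; a negative
  \<open>t\<close> gives the reversed inequality.\<close>

lemma rolle_scaled:
  fixes c :: "nat \<Rightarrow> real"
  assumes "u \<in> K" "v \<in> K" "u < v"
    and "t * combination \<phi> (Suc n) c u \<le> t * combination \<phi> (Suc n) c v"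
  shows "\<exists>z\<in>K. u \<le> z \<and> z < v \<and> 0 \<le> t * combination \<phi> n (\<lambda>k. real (Suc k) * c (Suc k)) z"
  using rolle[OF assms(1-3), of n "\<lambda>k. t * c k"] assms(4)
    combination_mult[of \<phi> n t "\<lambda>k. real (Suc k) * c (Suc k)"]
  by (simp add: combination_mult mult.left_commute)

lemma combination_eq_const:
  assumes "u \<in> K" "\<And>k. k \<le> n \<Longrightarrow> c (Suc k) = 0"
  shows "combination \<phi> (Suc n) c u = c 0"
  using assms basis_0
  unfolding combination_def by (subst sum.atMost_Suc_shift) simp

text \<open>A zero value counts as either sign. The sign \<open>s\<close> is arbitrary because the
  alternation of the derivative, to which the induction passes, starts with the opposite
  one.\<close>

lemma alternation_imp_zero:
  fixes c :: "nat \<Rightarrow> real"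
  assumes "\<And>i. i \<le> Suc n \<Longrightarrow> y i \<in> K" "\<And>i. i \<le> n \<Longrightarrow> y i < y (Suc i)" "s \<noteq> 0"
    and "\<And>i. i \<le> Suc n \<Longrightarrow> 0 \<le> s * (-1) ^ i * combination \<phi> n c (y i)"
    and "k \<le> n"
  shows "c k = 0"
  using assms
proof (induction n arbitrary: c y s k)
  case 0
  have "combination \<phi> 0 c (y i) = c 0" if "i \<le> Suc 0" for i
    using 0(1)[OF that] basis_0 by (simp add: combination_def)
  with 0(4)[of 0] 0(4)[of 1] have "s * c 0 = 0" by simp
  with 0 show ?case by simp
next
  case (Suc n)
  let ?c = "\<lambda>k. real (Suc k) * c (Suc k)"
  \<comment> \<open>The increment from \<open>y i\<close> to \<open>y (Suc i)\<close> has the weak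
    sign \<open>- s * (-1) ^ i\<close>, which Rolle passes on to the derivative.\<close>
  have "\<exists>z\<in>K. y i \<le> z \<and> z < y (Suc i) \<and> 0 \<le> - s * (-1) ^ i * combination \<phi> n ?c z"
    if "i \<le> Suc n" for i
    using Suc.prems(4)[of i] Suc.prems(4)[of "Suc i"] that
    by (intro rolle_scaled Suc.prems) auto
  then obtain z where z: "\<And>i. i \<le> Suc n \<Longrightarrow> z i \<in> K \<and> y i \<le> z i \<and> z i < y (Suc i) \<and>
      0 \<le> - s * (-1) ^ i * combination \<phi> n ?c (z i)" by metis
  have "z i < z (Suc i)" if "i \<le> n" for i
    using z[of i] z[of "Suc i"] that by auto
  then have "?c k = 0" if "k \<le> n" for k
    using z Suc.prems(3) that by (intro Suc.IH[where c = ?c and y = z and s = "- s"]) auto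
  then have c: "c (Suc k) = 0" if "k \<le> n" for k
    using that by auto
  \<comment> \<open>Only the constant is left, and two successive points of the alternation bound
    \<open>s * c 0\<close> by zero from both sides.\<close>
  have "combination \<phi> (Suc n) c (y i) = c 0" if "i \<le> Suc (Suc n)" for i
    using Suc.prems(1)[OF that] c by (rule combination_eq_const)
  with Suc.prems(4)[of 0] Suc.prems(4)[of 1] have "s * c 0 = 0" by simp
  with Suc.prems(3) have "c 0 = 0" by simp
  with c Suc.prems(5) show ?case by (cases k) auto
qed

text \<open>Between neighbouring zeros the increment is zero, so the derivative is somewhere
  nonnegative and somewhere nonpositive in each gap. Either it has a zero in every gap, and the
  induction hypothesis applies, or some gap has a strict sign change, and the alternation lemma
  applies.\<close>

lemma zeros_imp_zero:
  fixes c :: "nat \<Rightarrow> real"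
  assumes "\<And>i. i \<le> n \<Longrightarrow> y i \<in> K" "\<And>i. i < n \<Longrightarrow> y i < y (Suc i)"
    and "\<And>i. i \<le> n \<Longrightarrow> combination \<phi> n c (y i) = 0"
    and "k \<le> n"
  shows "c k = 0"
  using assms
proof (induction n arbitrary: c y k)
  case 0
  then show ?case using basis_0[of "y 0"] by (simp add: combination_def)
next
  case (Suc n)
  let ?c = "\<lambda>k. real (Suc k) * c (Suc k)"
  let ?p = "combination \<phi> n ?c"
  \<comment> \<open>Both endpoint values are zero, so Rolle can be used with any factor
    \<open>t\<close>: the sign in each gap may be prescribed.\<close>
  have "\<exists>z. z \<in> K \<and> y i \<le> z \<and> z < y (Suc i) \<and> 0 \<le> t * ?p z" if "i \<le> n" for i t
    using Suc.prems(3)[of i] Suc.prems(3)[of "Suc i"] that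
      rolle_scaled[OF Suc.prems(1)[of i] Suc.prems(1)[of "Suc i"] Suc.prems(2)[of i], of t n c]
    by auto
  then obtain z where z: "\<And>i t. i \<le> n \<Longrightarrow> z i t \<in> K \<and> y i \<le> z i t \<and> z i t < y (Suc i) \<and>
      0 \<le> t * ?p (z i t)" by metis
  have "?c k = 0" if "k \<le> n" for k
  proof (cases "\<forall>i\<le>n. \<exists>x\<in>K. y i \<le> x \<and> x < y (Suc i) \<and> ?p x = 0")
    case True
    then obtain x where x: "\<And>i. i \<le> n \<Longrightarrow> x i \<in> K \<and> y i \<le> x i \<and> x i < y (Suc i) \<and> ?p (x i) = 0"
      by metis
    have "x i < x (Suc i)" if "i < n" for i
      using x[of i] x[of "Suc i"] that by auto
    then show ?thesis
      using x that by (intro Suc.IH[where c = ?c and y = x]) auto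
  next
    text \<open>If the derivative has no zero in the \<open>j\<close>-th gap, it takes both signs there, so that
      gap contributes two points of an alternation and every other gap one point.\<close>
    case False
    then obtain j where j: "j \<le> n" "\<And>x. \<lbrakk>x \<in> K; y j \<le> x; x < y (Suc j)\<rbrakk> \<Longrightarrow> ?p x \<noteq> 0"
      by blast
    have pos: "?p (z j 1) > 0" and neg: "?p (z j (-1)) < 0"
      using z[OF j(1), of 1] z[OF j(1), of "-1"] j(2)[of "z j 1"] j(2)[of "z j (-1)"] by force+
    \<comment> \<open>Which of the two signs comes first is unknown; \<open>t\<close> records the
      sign at the left point.\<close>
    have "\<exists>x1 x2 t. x1 \<in> {z j 1, z j (-1)} \<and> x2 \<in> {z j 1, z j (-1)} \<and> x1 < x2 \<and> t \<noteq> 0 \<and>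
        0 \<le> t * ?p x1 \<and> 0 \<le> - t * ?p x2"
    proof (cases "z j 1 < z j (-1)")
      case True
      then show ?thesis
        using pos neg by (intro exI[of _ "z j 1"] exI[of _ "z j (-1)"] exI[of _ 1]) auto
    next
      case False
      then have "z j (-1) < z j 1"
        using pos neg by (metis less_asym linorder_less_linear)
      then show ?thesis
        using pos neg by (intro exI[of _ "z j 1"] exI[of _ "z j (-1)"] exI[of _ "-1"]) auto
    qed
    then obtain x1 x2 t where x12: "x1 \<in> {z j 1, z j (-1)}" "x2 \<in> {z j 1, z j (-1)}" "x1 < x2"
      "t \<noteq> 0" "0 \<le> t * ?p x1" "0 \<le> - t * ?p x2" by blast
    \<comment> \<open>The sign \<open>s\<close> is fixed by requiring that index \<open>j\<close>
      carry the sign \<open>t\<close>. Gap \<open>j\<close> supplies both \<open>x1\<close> and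
      \<open>x2\<close>, so every later point comes from the gap whose index is one lower.\<close>
    define s where "s = t * (-1) ^ j"
    define w where "w i = (if i < j then z i (s * (-1) ^ i) else if i = j then x1
      else if i = Suc j then x2 else z (i - 1) (s * (-1) ^ i))" for i
    have s: "s * (-1) ^ j = t"
      by (simp add: s_def mult.assoc flip: power_add)
    have lower: "w i \<in> K \<and> y i \<le> w i \<and> w i < y (Suc i)" if "i \<le> j" for i
      using that z[of i] z[of j] j(1) x12(1) by (auto simp: w_def)
    have upper: "w (Suc i) \<in> K \<and> y i \<le> w (Suc i) \<and> w (Suc i) < y (Suc i)" if "j \<le> i" "i \<le> n" for i
      using that z[of i] z[of j] j(1) x12(2) by (auto simp: w_def)
    have "w i \<in> K" if "i \<le> Suc n" for i
      using lower[of i] upper[of "i - 1"] that by (cases "i \<le> j") auto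
    moreover have "w i < w (Suc i)" if "i \<le> n" for i
    proof -
      consider "i < j" | "i = j" | "j < i" by linarith
      then show ?thesis
      proof cases
        case 1
        then show ?thesis using lower[of i] lower[of "Suc i"] by auto
      next
        case 2
        then show ?thesis using x12(3) by (simp add: w_def)
      next
        case 3
        then have "j \<le> i - 1" "i - 1 \<le> n" "Suc (i - 1) = i" using that by auto
        then show ?thesis using upper[of "i - 1"] upper[of i] that 3 by force
      qed
    qed
    moreover have "0 \<le> s * (-1) ^ i * ?p (w i)" if "i \<le> Suc n" for i
      using that z[of i "s * (-1) ^ i"] z[of "i - 1" "s * (-1) ^ i"] j(1) x12(5,6) s
      by (auto simp: w_def)
    moreover have "s \<noteq> 0"
      using x12(4) by (simp add: s_def)
    ultimately show ?thesis
      using that by (intro alternation_imp_zero[where c = ?c and y = w and s = s]) auto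
  qed
  then have c: "c (Suc k) = 0" if "k \<le> n" for k
    using that by auto
  have "combination \<phi> (Suc n) c (y 0) = c 0"
    using Suc.prems(1)[of 0] c by (intro combination_eq_const) auto
  with Suc.prems(3)[of 0] have "c 0 = 0" by simp
  with c Suc.prems(4) show ?case by (cases k) auto
qed

lemma zero_set_imp_zero:
  fixes c :: "nat \<Rightarrow> real"
  assumes "finite S" "S \<subseteq> K" "card S = Suc n"
    and "\<And>u. u \<in> S \<Longrightarrow> combination \<phi> n c u = 0" and "k \<le> n"
  shows "c k = 0"
proof -
  let ?y = "\<lambda>i. sorted_list_of_set S ! i"
  have len: "length (sorted_list_of_set S) = Suc n"
    using assms(3) by simp
  have "?y i \<in> S" if "i \<le> n" for i
    using that len nth_mem[of i "sorted_list_of_set S"] assms(1) by simp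
  moreover have "?y i < ?y (Suc i)" if "i < n" for i
    using that len strict_sorted_list_of_set[of S] by (simp add: sorted_wrt_nth_less)
  ultimately show ?thesis
    using assms by (intro zeros_imp_zero[where c = c and y = ?y]) auto
qed

end

section \<open>Best approximation by Haar systems\<close>

text \<open>The last assumption is the Haar condition at every order at once: each initial segment
  of the basis is a Chebyshev system on \<open>K\<close>. All orders occur because interpolation
  adds one basis function per node.\<close>

locale haar_system =
  fixes \<phi> :: "nat \<Rightarrow> real \<Rightarrow> real" and K :: "real set"
  assumes compact: "compact K" and nonempty: "K \<noteq> {}"
    and continuous: "continuous_on K (\<phi> k)"
    and haar_real: "\<lbrakk>finite S; S \<subseteq> K; card S = Suc n; \<And>u. u \<in> S \<Longrightarrow> combination \<phi> n c u = (0::real);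
      k \<le> n\<rbrakk> \<Longrightarrow> c k = 0"
begin

lemma haar:
  fixes c :: "nat \<Rightarrow> 'a::{real_normed_field, euclidean_space}"
  assumes "finite S" "S \<subseteq> K" "card S = Suc n" "\<And>u. u \<in> S \<Longrightarrow> combination \<phi> n c u = 0" "k \<le> n"
  shows "c k = 0"
proof (rule euclidean_eqI)
  fix b :: 'a
  have "combination \<phi> n (\<lambda>k. c k \<bullet> b) u = 0" if "u \<in> S" for u
    using assms(4)[OF that] by (simp flip: inner_combination)
  then show "c k \<bullet> b = 0 \<bullet> b"
    using haar_real[OF assms(1-3), of "\<lambda>k. c k \<bullet> b"] assms(5) by simp
qed

text \<open>Newton's scheme: a new node is met by adding a multiple of a combination that vanishes
  at the old ones. Padding the coefficients with zeros lets one family serve all orders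
  \<open>n\<close>, and the bound \<open>card S \<le> Suc n\<close> includes the empty set without
  subtraction.\<close>

lemma newton_interpolation:
  fixes r :: "real \<Rightarrow> 'a::{real_normed_field, euclidean_space}"
  assumes "finite S" "S \<subseteq> K"
  shows "\<exists>c. (\<forall>k\<ge>card S. c k = 0) \<and> (\<forall>n u. card S \<le> Suc n \<longrightarrow> u \<in> S \<longrightarrow> combination \<phi> n c u = r u)"
  using assms
proof (induction S arbitrary: r rule: finite_induct)
  case empty
  show ?case by (intro exI[of _ "\<lambda>_. 0"]) auto
next
  case (insert x S)
  let ?m = "card S"
  obtain c where c: "\<And>k. k \<ge> ?m \<Longrightarrow> c k = 0"
    "\<And>n u. card S \<le> Suc n \<Longrightarrow> u \<in> S \<Longrightarrow> combination \<phi> n c u = r u"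
    using insert.IH[of r] insert.prems by (metis insert_subset)
  obtain d where d: "\<And>k. k \<ge> ?m \<Longrightarrow> d k = (0::'a)"
    "\<And>n u. card S \<le> Suc n \<Longrightarrow> u \<in> S \<Longrightarrow> combination \<phi> n d u = of_real (\<phi> ?m u)"
    using insert.IH[of "\<lambda>u. of_real (\<phi> ?m u)"] insert.prems by (metis insert_subset)
  \<comment> \<open>The Newton function: the next basis function minus its interpolant on
    \<open>S\<close>.\<close>
  define q where "q k = (if k = ?m then 1 else 0) - d k" for k
  have q0: "combination \<phi> n q u = 0" if "?m \<le> n" "u \<in> S" for n u
  proof -
    have "combination \<phi> n (\<lambda>k. if k = ?m then 1 else 0) u = of_real (\<phi> ?m u)"
      using that(1) by (simp add: combination_def if_distrib[of "\<lambda>x. x * _"] cong: if_cong)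
    then show ?thesis
      using d(2)[of n u] that unfolding q_def combination_diff by simp
  qed
  have trunc: "combination \<phi> n q x = combination \<phi> ?m q x" if "?m \<le> n" for n
    using that d(1) by (intro combination_truncate) (auto simp: q_def)
  have trunc_c: "combination \<phi> n c x = combination \<phi> ?m c x" if "?m \<le> n" for n
    using that c(1) by (intro combination_truncate) auto
  \<comment> \<open>Otherwise \<open>q\<close> would vanish at \<open>Suc ?m\<close> points,
    although its leading coefficient is 1.\<close>
  have ne: "combination \<phi> ?m q x \<noteq> 0"
  proof
    assume "combination \<phi> ?m q x = 0"
    then have "q ?m = 0"
      using insert q0[of ?m] by (intro haar[of "insert x S" ?m q]) auto
    then show False using d(1) by (simp add: q_def)
  qed
  obtain t where t: "t * combination \<phi> ?m q x = r x - combination \<phi> ?m c x"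
    using ne by (metis nonzero_eq_divide_eq)
  show ?case
  proof (intro exI[of _ "\<lambda>k. c k + t * q k"] conjI allI impI)
    fix k assume "card (insert x S) \<le> k"
    then show "c k + t * q k = 0"
      using insert(1,2) c(1) d(1) by (simp add: q_def)
  next
    fix n u assume "card (insert x S) \<le> Suc n" "u \<in> insert x S"
    then show "combination \<phi> n (\<lambda>k. c k + t * q k) u = r u"
      using insert(1,2) c(2)[of n u] q0[of n u] trunc[of n] trunc_c[of n] t
      by (auto simp: combination_add combination_mult)
  qed
qed

lemma interpolation:
  fixes r :: "real \<Rightarrow> 'a::{real_normed_field, euclidean_space}"
  assumes "finite S" "S \<subseteq> K" "card S \<le> Suc n"
  shows "\<exists>c. \<forall>u\<in>S. combination \<phi> n c u = r u"
  using newton_interpolation[OF assms(1,2), of r] assms(3) by blast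

end

text \<open>Bolzano-Weierstrass, thinning the subsequence once for each index in
  \<open>S\<close>.\<close>

lemma bounded_sequences_convergent_subsequence:
  fixes v :: "'i \<Rightarrow> nat \<Rightarrow> 'a::euclidean_space"
  assumes "finite S" "\<And>y. y \<in> S \<Longrightarrow> bounded (range (v y))"
  shows "\<exists>r l. strict_mono r \<and> (\<forall>y\<in>S. (\<lambda>m. v y (r m)) \<longlonglongrightarrow> l y)"
  using assms
proof (induction S rule: finite_induct)
  case empty
  show ?case by (intro exI[of _ id]) (auto simp: strict_mono_def)
next
  case (insert x S)
  then obtain r l where r: "strict_mono (r :: nat \<Rightarrow> nat)"
    "\<And>y. y \<in> S \<Longrightarrow> (\<lambda>m. v y (r m)) \<longlonglongrightarrow> l y" by auto
  have "bounded (range (\<lambda>m. v x (r m)))"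
    using insert.prems[of x] by (rule bounded_subset) auto
  then obtain L r' where r': "strict_mono (r' :: nat \<Rightarrow> nat)" "((\<lambda>m. v x (r m)) \<circ> r') \<longlonglongrightarrow> L"
    using bounded_imp_convergent_subsequence by blast
  have "(\<lambda>m. v y (r (r' m))) \<longlonglongrightarrow> (l(x := L)) y" if "y \<in> insert x S" for y
    using that r'(2) LIMSEQ_subseq_LIMSEQ[OF r(2) r'(1), of y] by (auto simp: o_def)
  then show ?case
    using strict_mono_o[OF r(1) r'(1)] by (intro exI[of _ "r \<circ> r'"] exI[of _ "l(x := L)"]) (auto simp: o_def)
qed

section \<open>Existence and uniqueness of best approximations on a compact set\<close>

context haar_system
begin

definition deviation ::
  "(real \<Rightarrow> 'a) \<Rightarrow> nat \<Rightarrow> (nat \<Rightarrow> 'a::{real_normed_field, euclidean_space}) \<Rightarrow> real" where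
  "deviation F n c = (SUP u\<in>K. norm (F u - combination \<phi> n c u))"

lemma continuous_on_basis_combination: "continuous_on K (combination \<phi> n c)"
  by (rule continuous_on_combination) (rule continuous)

lemma deviation_attained:
  fixes F :: "real \<Rightarrow> 'a::{real_normed_field, euclidean_space}"
  assumes "continuous_on K F"
  shows "\<exists>u\<in>K. deviation F n c = norm (F u - combination \<phi> n c u)"
    and "u \<in> K \<Longrightarrow> norm (F u - combination \<phi> n c u) \<le> deviation F n c"
proof -
  have "continuous_on K (\<lambda>u. norm (F u - combination \<phi> n c u))"
    by (intro continuous_intros assms continuous_on_basis_combination)
  then obtain x where x: "x \<in> K"
    "\<And>u. u \<in> K \<Longrightarrow> norm (F u - combination \<phi> n c u) \<le> norm (F x - combination \<phi> n c x)"
    using continuous_attains_sup[OF compact nonempty] by blast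
  then have "deviation F n c = norm (F x - combination \<phi> n c x)"
    unfolding deviation_def by (intro cSup_eq_maximum) auto
  with x show "\<exists>u\<in>K. deviation F n c = norm (F u - combination \<phi> n c u)"
    "u \<in> K \<Longrightarrow> norm (F u - combination \<phi> n c u) \<le> deviation F n c"
    by auto
qed

lemma deviation_nonneg:
  fixes F :: "real \<Rightarrow> 'a::{real_normed_field, euclidean_space}"
  assumes "continuous_on K F"
  shows "0 \<le> deviation F n c"
  using deviation_attained(1)[OF assms, of n c] by auto

text \<open>The coefficients of the Lagrange functions at the nodes express every coefficient
  linearly through nodal values, so convergence at the nodes implies convergence of the
  coefficients.\<close>

lemma lagrange_basis:
  assumes "finite S" "S \<subseteq> K" "card S = Suc n"
  obtains L :: "real \<Rightarrow> nat \<Rightarrow> 'a::{real_normed_field, euclidean_space}" where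
    "\<And>c k. k \<le> n \<Longrightarrow> c k = (\<Sum>y\<in>S. combination \<phi> n c y * L y k)"
proof -
  have "\<exists>l :: nat \<Rightarrow> 'a. \<forall>u\<in>S. combination \<phi> n l u = (if u = y then 1 else 0)" for y
    using assms by (intro interpolation) auto
  then obtain L :: "real \<Rightarrow> nat \<Rightarrow> 'a" where
    L: "\<And>y u. u \<in> S \<Longrightarrow> combination \<phi> n (L y) u = (if u = y then 1 else 0)" by metis
  have "c k = (\<Sum>y\<in>S. combination \<phi> n c y * L y k)" if "k \<le> n" for c k
  proof -
    let ?d = "\<lambda>k. c k - (\<Sum>y\<in>S. combination \<phi> n c y * L y k)"
    have "combination \<phi> n ?d u = 0" if "u \<in> S" for u
      using that assms(1)
      by (simp add: combination_diff combination_sum L if_distrib[of "\<lambda>x. _ * x"] cong: if_cong)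
    then have "?d k = 0"
      using that by (intro haar[OF assms, where c = ?d]) auto
    then show ?thesis by simp
  qed
  then show ?thesis by (rule that)
qed

text \<open>If \<open>K\<close> has at most \<open>Suc n\<close> points, interpolation gives error
  zero. Otherwise a minimising sequence has bounded values at \<open>Suc n\<close> nodes; along a
  subsequence these values, hence the coefficients, converge to a minimiser.\<close>

lemma best_approximation_exists:
  fixes F :: "real \<Rightarrow> 'a::{real_normed_field, euclidean_space}"
  assumes F: "continuous_on K F"
  shows "\<exists>c. \<forall>c'. deviation F n c \<le> deviation F n c'"
proof (cases "finite K \<and> card K \<le> Suc n")
  case True
  then obtain c where "\<And>u. u \<in> K \<Longrightarrow> combination \<phi> n c u = F u"
    using interpolation[of K n F] by auto
  then have "deviation F n c = 0"
    using deviation_attained(1)[OF F, of n c] by auto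
  then show ?thesis using deviation_nonneg[OF F] by metis
next
  case False
  have "\<exists>S\<subseteq>K. finite S \<and> card S = Suc n"
  proof (cases "finite K")
    case True
    with False obtain S where "S \<subseteq> K" "card S = Suc n"
      using obtain_subset_with_card_n[of "Suc n" K] by auto
    then show ?thesis using finite_subset[OF _ True] by auto
  qed (use infinite_arbitrarily_large in blast)
  then obtain S where S: "finite S" "S \<subseteq> K" "card S = Suc n" by blast
  obtain L :: "real \<Rightarrow> nat \<Rightarrow> 'a" where
    L: "\<And>c k. k \<le> n \<Longrightarrow> c k = (\<Sum>y\<in>S. combination \<phi> n c y * L y k)"
    using lagrange_basis[OF S, where 'a = 'a] by blast
  define d where "d = (INF c. deviation F n c)"
  have bdd: "bdd_below (range (deviation F n))"
    using deviation_nonneg[OF F] by (intro bdd_belowI[of _ 0]) auto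
  have "\<exists>c. deviation F n c < d + 1 / real (Suc m)" for m
    using bdd cINF_less_iff[of UNIV "deviation F n" "d + 1 / real (Suc m)"]
    by (auto simp: d_def)
  then obtain c where c: "\<And>m. deviation F n (c m) < d + 1 / real (Suc m)" by metis
  have "bounded (range (\<lambda>m. combination \<phi> n (c m) y))" if "y \<in> S" for y
    unfolding bounded_iff
  proof (intro exI[of _ "norm (F y) + d + 1"] ballI)
    fix x assume "x \<in> range (\<lambda>m. combination \<phi> n (c m) y)"
    then obtain m where x: "x = combination \<phi> n (c m) y" by auto
    have "norm x \<le> norm (F y) + norm (F y - x)"
      by (metis norm_minus_commute norm_triangle_sub)
    also have "norm (F y - x) \<le> deviation F n (c m)"
      using deviation_attained(2)[OF F, of y] S(2) that x by auto
    also have "\<dots> \<le> d + 1 / real (Suc m)"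
      using c[of m] by simp
    also have "\<dots> \<le> d + 1" by simp
    finally show "norm x \<le> norm (F y) + d + 1" by simp
  qed
  then obtain r l where r: "strict_mono (r :: nat \<Rightarrow> nat)"
    "\<And>y. y \<in> S \<Longrightarrow> (\<lambda>m. combination \<phi> n (c (r m)) y) \<longlonglongrightarrow> l y"
    using bounded_sequences_convergent_subsequence[OF S(1), of "\<lambda>y m. combination \<phi> n (c m) y"]
    by blast
  \<comment> \<open>The coefficients determined by the limiting nodal values.\<close>
  define c0 where "c0 k = (\<Sum>y\<in>S. l y * L y k)" for k
  have lim_c: "(\<lambda>m. c (r m) k) \<longlonglongrightarrow> c0 k" if "k \<le> n" for k
  proof -
    have "(\<lambda>m. \<Sum>y\<in>S. combination \<phi> n (c (r m)) y * L y k) \<longlonglongrightarrow> c0 k"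
      unfolding c0_def by (intro tendsto_intros r)
    then show ?thesis
      using L[OF that] by simp
  qed
  have "norm (F u - combination \<phi> n c0 u) \<le> d" if "u \<in> K" for u
  proof (rule LIMSEQ_le)
    show "(\<lambda>m. norm (F u - combination \<phi> n (c (r m)) u)) \<longlonglongrightarrow> norm (F u - combination \<phi> n c0 u)"
      unfolding combination_def by (intro tendsto_intros lim_c) auto
    have "(\<lambda>m. d + 1 / real (Suc m)) \<longlonglongrightarrow> d + 0"
      by (intro tendsto_intros LIMSEQ_Suc lim_inverse_n')
    from LIMSEQ_subseq_LIMSEQ[OF this r(1)]
    show "(\<lambda>m. d + 1 / real (Suc (r m))) \<longlonglongrightarrow> d" by (simp add: o_def)
    show "\<exists>N. \<forall>m\<ge>N. norm (F u - combination \<phi> n (c (r m)) u) \<le> d + 1 / real (Suc (r m))"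
      using deviation_attained(2)[OF F that, of n] c by (meson less_imp_le order_trans)
  qed
  then have "deviation F n c0 \<le> d"
    using deviation_attained(1)[OF F, of n c0] by auto
  also have "d \<le> deviation F n c'" for c'
    unfolding d_def by (intro cINF_lower bdd) auto
  finally show ?thesis by blast
qed

text \<open>With too few extremal points, the error could be interpolated on all of them by some
  \<open>q\<close>; adding a small multiple of \<open>q\<close> to the approximation would then
  reduce the deviation.\<close>

lemma best_approximation_extremal_points:
  fixes F :: "real \<Rightarrow> 'a::{real_normed_field, euclidean_space}"
  assumes F: "continuous_on K F" and best: "\<And>c'. deviation F n c \<le> deviation F n c'"
    and pos: "0 < deviation F n c"
  shows "\<exists>S\<subseteq>{u \<in> K. norm (F u - combination \<phi> n c u) = deviation F n c}.
    finite S \<and> card S = Suc n"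
proof (rule ccontr)
  let ?d = "deviation F n c"
  define h where "h u = F u - combination \<phi> n c u" for u
  define E where "E = {u \<in> K. norm (h u) = ?d}"
  assume "\<not> ?thesis"
  then have no: "\<And>S. S \<subseteq> E \<Longrightarrow> finite S \<Longrightarrow> card S \<noteq> Suc n"
    by (auto simp: E_def h_def)
  have finE: "finite E"
    using no infinite_arbitrarily_large by blast
  have "card E \<le> Suc n"
  proof (rule ccontr)
    assume "\<not> card E \<le> Suc n"
    then obtain S where "S \<subseteq> E" "card S = Suc n" "finite S"
      using obtain_subset_with_card_n[of "Suc n" E] by auto
    with no show False by auto
  qed
  then obtain q where q: "\<And>u. u \<in> E \<Longrightarrow> combination \<phi> n q u = h u"
    using interpolation[of E n h] finE by (auto simp: E_def)
  define Q where "Q u = combination \<phi> n q u" for u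
  have cont_Q: "continuous_on K Q"
    unfolding Q_def by (rule continuous_on_basis_combination)
  have cont_h: "continuous_on K h"
    unfolding h_def by (intro continuous_intros F continuous_on_basis_combination)
  obtain B where B: "\<And>u. u \<in> K \<Longrightarrow> norm (Q u) \<le> B" "0 < B"
    using compact_imp_bounded[OF compact_continuous_image[OF cont_Q compact]]
    unfolding bounded_pos by auto
  have h_le: "norm (h u) \<le> ?d" if "u \<in> K" for u
    using deviation_attained(2)[OF F that] by (simp add: h_def)
  text \<open>Away from \<open>E\<close> the error stays below the deviation by a margin; near \<open>E\<close> a small
    multiple of \<open>q\<close> decreases it.\<close>
  define K1 where "K1 = {u \<in> K. h u \<bullet> Q u \<le> ?d\<^sup>2 / 2}"
  have "closed K1"
    unfolding K1_def using compact
    by (intro continuous_on_closed_Collect_le continuous_intros cont_h cont_Q compact_imp_closed)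
  then have "compact K1"
    using compact_Int_closed[OF compact, of K1] by (simp add: K1_def Int_absorb1 subset_iff)
  have K1_less: "norm (h u) < ?d" if "u \<in> K1" for u
  proof -
    have "u \<notin> E"
    proof
      assume "u \<in> E"
      then have "h u \<bullet> Q u = ?d\<^sup>2"
        using q by (simp add: Q_def E_def power2_norm_eq_inner[symmetric])
      with that pos show False by (simp add: K1_def)
    qed
    with h_le[of u] that show ?thesis by (auto simp: K1_def E_def)
  qed
  \<comment> \<open>By compactness the strict inequality on \<open>K1\<close> becomes uniform; if
    \<open>K1\<close> is empty any number below the deviation will do.\<close>
  obtain M where M: "M < ?d" "\<And>u. u \<in> K1 \<Longrightarrow> norm (h u) \<le> M"
  proof (cases "K1 = {}")
    case True
    with that[of "?d - 1"] show ?thesis by auto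
  next
    case False
    have "continuous_on K1 (\<lambda>u. norm (h u))"
      by (intro continuous_intros continuous_on_subset[OF cont_h]) (auto simp: K1_def)
    then obtain x where "x \<in> K1" "\<And>u. u \<in> K1 \<Longrightarrow> norm (h u) \<le> norm (h x)"
      using continuous_attains_sup[OF \<open>compact K1\<close> False] by metis
    with that[of "norm (h x)"] K1_less show ?thesis by auto
  qed
  \<comment> \<open>The first bound keeps the perturbation within the margin on \<open>K1\<close>;
    the second keeps its quadratic cost below the linear gain off \<open>K1\<close>.\<close>
  define \<epsilon> where "\<epsilon> = min ((?d - M) / (2 * B)) (?d\<^sup>2 / (2 * B\<^sup>2))"
  have \<epsilon>: "0 < \<epsilon>" "\<epsilon> * B < ?d - M" "\<epsilon> * B\<^sup>2 < ?d\<^sup>2"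
  proof -
    show "0 < \<epsilon>" using B pos M by (simp add: \<epsilon>_def)
    have "\<epsilon> * B \<le> (?d - M) / (2 * B) * B"
      using B by (intro mult_right_mono) (auto simp: \<epsilon>_def)
    also have "\<dots> < ?d - M" using B M by simp
    finally show "\<epsilon> * B < ?d - M" .
    have "\<epsilon> * B\<^sup>2 \<le> ?d\<^sup>2 / (2 * B\<^sup>2) * B\<^sup>2"
      using B by (intro mult_right_mono) (auto simp: \<epsilon>_def)
    also have "\<dots> < ?d\<^sup>2" using B pos by simp
    finally show "\<epsilon> * B\<^sup>2 < ?d\<^sup>2" .
  qed
  define c' where "c' = (\<lambda>k. c k + of_real \<epsilon> * q k)"
  have diff: "F u - combination \<phi> n c' u = h u - \<epsilon> *\<^sub>R Q u" for u
    by (simp add: c'_def combination_add combination_mult h_def Q_def scaleR_conv_of_real)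
  have "norm (h u - \<epsilon> *\<^sub>R Q u) < ?d" if u: "u \<in> K" for u
  proof (cases "u \<in> K1")
    case True
    have "norm (h u - \<epsilon> *\<^sub>R Q u) \<le> norm (h u) + \<epsilon> * norm (Q u)"
      using norm_triangle_ineq4[of "h u" "\<epsilon> *\<^sub>R Q u"] \<epsilon>(1) by simp
    also have "\<dots> \<le> M + \<epsilon> * B"
      using M(2)[OF True] B(1)[OF u] \<epsilon>(1) by (intro add_mono mult_left_mono) auto
    also have "\<dots> < ?d" using \<epsilon>(2) by simp
    finally show ?thesis .
  next
    case False
    then have hQ: "?d\<^sup>2 / 2 < h u \<bullet> Q u" using u by (simp add: K1_def)
    \<comment> \<open>Off \<open>K1\<close> the inner product exceeds half the squared deviation, so
      the middle term gains more than \<open>\<epsilon> * ?d\<^sup>2\<close>.\<close>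
    have "(norm (h u - \<epsilon> *\<^sub>R Q u))\<^sup>2 = (norm (h u))\<^sup>2 - 2 * \<epsilon> * (h u \<bullet> Q u) + \<epsilon> * (\<epsilon> * (norm (Q u))\<^sup>2)"
      unfolding power2_norm_eq_inner
      by (simp add: inner_diff_left inner_diff_right inner_commute[of "Q u" "h u"] algebra_simps)
    also have "\<dots> \<le> ?d\<^sup>2 - 2 * \<epsilon> * (?d\<^sup>2 / 2) + \<epsilon> * (\<epsilon> * B\<^sup>2)"
      using h_le[OF u] hQ \<epsilon>(1) B(1)[OF u]
      by (intro add_mono diff_mono mult_left_mono power_mono) auto
    also have "\<dots> = ?d\<^sup>2 - \<epsilon> * (?d\<^sup>2 - \<epsilon> * B\<^sup>2)" by (simp add: algebra_simps)
    also have "\<dots> < ?d\<^sup>2" using \<epsilon> by simp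
    finally show ?thesis using pos by (simp add: power2_less_imp_less)
  qed
  then have "deviation F n c' < ?d"
    using deviation_attained(1)[OF F, of n c'] diff by auto
  with best[of c'] show False by simp
qed

text \<open>The midpoint of two minimisers is again one. At its extremal points strict convexity of
  the Euclidean norm makes both errors equal, and there are enough such points for the Haar
  condition. Values are compared rather than coefficients, since a \<open>K\<close> with fewer than
  \<open>Suc n\<close> points does not determine the latter.\<close>

lemma best_approximation_unique:
  fixes F :: "real \<Rightarrow> 'a::{real_normed_field, euclidean_space}"
  assumes F: "continuous_on K F"
    and best1: "\<And>c. deviation F n c1 \<le> deviation F n c" and best2: "\<And>c. deviation F n c2 \<le> deviation F n c"
    and u: "u \<in> K"
  shows "combination \<phi> n c1 u = combination \<phi> n c2 u"
proof -
  let ?d = "deviation F n c1"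
  have d2: "deviation F n c2 = ?d" by (intro antisym best1 best2)
  define c where "c = (\<lambda>k. of_real (1 / 2) * (c1 k + c2 k))"
  define h1 where "h1 u = F u - combination \<phi> n c1 u" for u
  define h2 where "h2 u = F u - combination \<phi> n c2 u" for u
  have h: "F u - combination \<phi> n c u = (1 / 2) *\<^sub>R (h1 u + h2 u)" for u
  proof -
    have "combination \<phi> n c u = (1 / 2) *\<^sub>R (combination \<phi> n c1 u + combination \<phi> n c2 u)"
      by (simp only: c_def combination_mult combination_add scaleR_conv_of_real)
    moreover have "F u = (1 / 2) *\<^sub>R (F u + F u)" by simp
    ultimately have "F u - combination \<phi> n c u =
        (1 / 2) *\<^sub>R ((F u + F u) - (combination \<phi> n c1 u + combination \<phi> n c2 u))"
      by (metis scaleR_diff_right)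
    then show ?thesis by (simp add: h1_def h2_def algebra_simps)
  qed
  have h1: "norm (h1 u) \<le> ?d" and h2: "norm (h2 u) \<le> ?d" if "u \<in> K" for u
    using deviation_attained(2)[OF F that, of n c1] deviation_attained(2)[OF F that, of n c2] d2
    by (auto simp: h1_def h2_def)
  have "norm (F u - combination \<phi> n c u) \<le> ?d" if "u \<in> K" for u
    using h1[OF that] h2[OF that] norm_triangle_ineq[of "h1 u" "h2 u"] unfolding h by simp
  then have "deviation F n c \<le> ?d"
    using deviation_attained(1)[OF F, of n c] by auto
  then have dc: "deviation F n c = ?d" by (intro antisym best1)
  show ?thesis
  \<comment> \<open>With zero deviation both combinations agree with \<open>F\<close> on
    \<open>K\<close>; the lemma on extremal points covers positive deviation.\<close>
  proof (cases "?d = 0")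
    case True
    then show ?thesis using h1[OF u] h2[OF u] by (simp add: h1_def h2_def)
  next
    case False
    then have "0 < deviation F n c"
      using deviation_nonneg[OF F] dc by (metis order_le_less)
    then obtain S where S: "S \<subseteq> {u \<in> K. norm (F u - combination \<phi> n c u) = ?d}" "finite S" "card S = Suc n"
      using best_approximation_extremal_points[OF F, of n c] best1 dc by auto
    have "combination \<phi> n (\<lambda>k. c1 k - c2 k) u = 0" if "u \<in> S" for u
    proof -
      have uK: "u \<in> K" and "norm ((1 / 2) *\<^sub>R (h1 u + h2 u)) = ?d"
        using S(1) that h by auto
      then have "norm (h1 u + h2 u) = 2 * ?d" by simp
      \<comment> \<open>The parallelogram law: the sum already has the largest possible norm, so
        nothing is left for the difference.\<close>
      moreover have "(norm (h1 u + h2 u))\<^sup>2 + (norm (h1 u - h2 u))\<^sup>2 = 2 * (norm (h1 u))\<^sup>2 + 2 * (norm (h2 u))\<^sup>2"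
        unfolding power2_norm_eq_inner by (simp add: inner_simps inner_commute)
      moreover have "(norm (h1 u))\<^sup>2 \<le> ?d\<^sup>2" "(norm (h2 u))\<^sup>2 \<le> ?d\<^sup>2"
        using h1[OF uK] h2[OF uK] by (auto intro: power_mono)
      ultimately have "(norm (h1 u - h2 u))\<^sup>2 \<le> 0" by (simp add: power2_eq_square)
      then show ?thesis by (simp add: h1_def h2_def combination_diff)
    qed
    then have "c1 k - c2 k = 0" if "k \<le> n" for k
      using S that by (intro haar[where c = "\<lambda>k. c1 k - c2 k"]) auto
    then show ?thesis by (intro combination_cong) auto
  qed
qed

end

section \<open>Change of variables for Stieltjes integrals\<close>

text \<open>Upper rays are stable under intersection and generate the Borel sets. They suit the
  change of variables, where the preimages of exactly these rays are explicit.\<close>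

lemma measure_eqI_atLeast:
  fixes M N :: "real measure"
  assumes sets: "sets M = sets borel" "sets N = sets borel"
    and fin: "\<And>x. emeasure M {x..} < \<infinity>"
    and eq: "\<And>x. emeasure M {x..} = emeasure N {x..}"
  shows "M = N"
proof (rule measure_eqI_generator_eq_countable)
  let ?E = "range (\<lambda>a::real. {a..})"
  have "{x..} \<inter> {y..} = {max x y..}" for x y :: real
    by auto
  then show "Int_stable ?E"
    unfolding Int_stable_def by blast
  show "?E \<subseteq> Pow UNIV" "sets M = sigma_sets UNIV ?E" "sets N = sigma_sets UNIV ?E"
    unfolding sets borel_Ici by auto
  show "atLeast ` \<rat> \<subseteq> ?E" "(\<Union>i\<in>\<rat>. {i..}) = (UNIV :: real set)"
    "\<And>a. a \<in> atLeast ` \<rat> \<Longrightarrow> emeasure M a \<noteq> \<infinity>"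
    using fin by (auto intro: Rats_no_bot_less less_imp_le simp: less_top)
      (metis Rats_no_bot_less less_imp_le)
qed (auto intro: eq countable_rat)

text \<open>The interval is to be the hull of the approximation interval and the base point; its
  boundedness keeps the generalised inverse bounded.\<close>

locale derivator_on =
  fixes g :: "real \<Rightarrow> real" and A B :: real
  assumes derivator: "derivator g" and A_le_B: "A \<le> B"
begin

lemma g_mono: "x \<le> y \<Longrightarrow> g x \<le> g y"
  using derivator by (auto simp: derivator_def mono_def)

text \<open>The point \<open>A\<close> is always included, so that the supremum below is never taken over the empty set.\<close>
definition sublevel :: "real \<Rightarrow> real set" where
  "sublevel s = {t \<in> {A..B}. t = A \<or> g t \<le> s}"

definition ginv :: "real \<Rightarrow> real" where
  "ginv s = Sup (sublevel s)"

lemma A_in_sublevel: "A \<in> sublevel s"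
  using A_le_B by (simp add: sublevel_def)

lemma bdd_above_sublevel: "bdd_above (sublevel s)"
  by (auto simp: sublevel_def intro: bdd_aboveI[of _ B])

lemma ginv_mem: "ginv s \<in> {A..B}"
proof -
  have "A \<le> ginv s"
    unfolding ginv_def by (intro cSup_upper A_in_sublevel bdd_above_sublevel)
  moreover have "ginv s \<le> B"
    unfolding ginv_def using A_in_sublevel by (intro cSup_least) (auto simp: sublevel_def)
  ultimately show ?thesis by simp
qed

lemma mono_ginv: "mono ginv"
  unfolding mono_def ginv_def using A_in_sublevel bdd_above_sublevel
  by (auto intro!: cSup_subset_mono simp: sublevel_def)

text \<open>Left continuity makes the supremum attained: a value above \<open>s\<close> at
  \<open>ginv s\<close> would force values above \<open>s\<close> just to the left, where members of
  the sublevel set lie unless \<open>ginv s\<close> is one itself.\<close>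

lemma g_ginv_le:
  assumes "g A \<le> s"
  shows "g (ginv s) \<le> s"
proof (rule ccontr)
  assume "\<not> g (ginv s) \<le> s"
  moreover have "(g \<longlongrightarrow> g (ginv s)) (at_left (ginv s))"
    using derivator by (simp add: derivator_def continuous_within)
  ultimately have "\<forall>\<^sub>F t in at_left (ginv s). s < g t"
    by (intro order_tendstoD) auto
  then obtain r where r: "r < ginv s" "\<And>t. r < t \<Longrightarrow> t < ginv s \<Longrightarrow> s < g t"
    unfolding eventually_at_left_field by blast
  obtain t where t: "t \<in> sublevel s" "r < t"
    using r(1) less_cSup_iff[OF _ bdd_above_sublevel, of s r] A_in_sublevel[of s]
    by (auto simp: ginv_def)
  have "g t \<le> s" using t(1) assms by (auto simp: sublevel_def)
  moreover have "t \<le> ginv s"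
    unfolding ginv_def by (intro cSup_upper t bdd_above_sublevel)
  ultimately show False
    using r(2)[OF t(2)] \<open>\<not> g (ginv s) \<le> s\<close> by (cases "t = ginv s") auto
qed

text \<open>A Galois connection, from which preimages under \<open>ginv\<close> are
  computed.\<close>

lemma le_ginv_iff:
  assumes "t \<in> {A..B}" "g A \<le> s"
  shows "t \<le> ginv s \<longleftrightarrow> g t \<le> s"
proof
  assume "t \<le> ginv s"
  then show "g t \<le> s" using g_mono g_ginv_le[OF assms(2)] by (meson order_trans)
next
  assume "g t \<le> s"
  then show "t \<le> ginv s"
    unfolding ginv_def using assms by (intro cSup_upper bdd_above_sublevel) (auto simp: sublevel_def)
qed

text \<open>The Stieltjes measure on \<open>{c..<d}\<close> is the image of Lebesgue measure on
  \<open>{g c..<g d}\<close> under \<open>ginv\<close>. The two measures are compared on upper rays,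
  according to the position of the ray's endpoint relative to \<open>c\<close> and
  \<open>d\<close>.\<close>

lemma stieltjes_set_integral:
  fixes h :: "real \<Rightarrow> real"
  assumes cd: "A \<le> c" "c \<le> d" "d \<le> B" and h: "h \<in> borel_measurable borel"
  shows "(LINT t:{c..<d}|stieltjes_measure g. h t) = (LINT s:{g c..<g d}|lborel. h (ginv s))"
proof -
  have [measurable]: "ginv \<in> borel_measurable borel"
    by (intro borel_measurable_mono mono_ginv)
  let ?M = "density (stieltjes_measure g) (indicator {c..<d})"
  let ?L = "density lborel (indicator {g c..<g d})"
  let ?N = "distr ?L borel ginv"
  have M: "emeasure ?M {x..} = emeasure (stieltjes_measure g) ({c..<d} \<inter> {x..})" for x
    by (subst emeasure_density) (simp_all add: borel_measurable_indicator flip: indicator_inter_arith)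
  have N: "emeasure ?N {x..} = emeasure lborel ({g c..<g d} \<inter> ginv -` {x..})" for x
  proof -
    have "ginv -` {x..} \<in> sets borel"
      using measurable_sets_borel[of ginv borel "{x..}"] by simp
    then show ?thesis
      by (subst emeasure_distr)
        (simp_all add: emeasure_density borel_measurable_indicator flip: indicator_inter_arith)
  qed
  have eq: "emeasure ?M {x..} = emeasure ?N {x..}" for x
  proof -
    have gA: "g A \<le> g c" using cd(1) by (rule g_mono)
    consider "x \<le> c" | "c < x" "x < d" | "d \<le> x" by linarith
    then show ?thesis
    proof cases
      case 1
      have "{c..<d} \<inter> {x..} = {c..<d}" using 1 by auto
      moreover have "{g c..<g d} \<inter> ginv -` {x..} = {g c..<g d}"
      proof -
        have "x \<le> ginv s" if "g c \<le> s" for s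
          using that 1 cd gA le_ginv_iff[of c s] by auto
        then show ?thesis by auto
      qed
      ultimately show ?thesis
        using cd g_mono[OF cd(2)] emeasure_stieltjes_measure_Ico[OF derivator] unfolding M N by simp
    next
      case 2
      have "{c..<d} \<inter> {x..} = {x..<d}" using 2 by auto
      moreover have "{g c..<g d} \<inter> ginv -` {x..} = {g x..<g d}"
        using 2 cd gA g_mono[of c x] le_ginv_iff[of x] by auto
      ultimately show ?thesis
        using 2 g_mono[of x d] emeasure_stieltjes_measure_Ico[OF derivator] unfolding M N by simp
    next
      case 3
      have "{c..<d} \<inter> {x..} = {}" using 3 by auto
      moreover have "{g c..<g d} \<inter> ginv -` {x..} = {}"
      proof -
        have False if "g c \<le> s" "s < g d" "x \<le> ginv s" for s
          using that 3 cd gA le_ginv_iff[of d s] by auto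
        then show ?thesis by auto
      qed
      ultimately show ?thesis unfolding M N by simp
    qed
  qed
  have "?M = ?N"
  proof (rule measure_eqI_atLeast)
    fix x
    have "emeasure ?M {x..} \<le> emeasure (stieltjes_measure g) {c..<d}"
      unfolding M by (intro emeasure_mono) auto
    also have "\<dots> < \<infinity>"
      using emeasure_stieltjes_measure_Ico[OF derivator cd(2)] by simp
    finally show "emeasure ?M {x..} < \<infinity>" .
  qed (simp_all add: eq)
  have "(LINT t:{c..<d}|stieltjes_measure g. h t) =
      integral\<^sup>L (density (stieltjes_measure g) (\<lambda>x. ennreal (indicator {c..<d} x))) h"
    unfolding set_lebesgue_integral_def using h by (subst integral_density) auto
  also have "\<dots> = integral\<^sup>L ?M h"
    by (simp add: ennreal_indicator)
  also have "\<dots> = integral\<^sup>L ?L (\<lambda>s. h (ginv s))"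
    unfolding \<open>?M = ?N\<close> using h by (subst integral_distr) auto
  also have "\<dots> = integral\<^sup>L (density lborel (\<lambda>x. ennreal (indicator {g c..<g d} x))) (\<lambda>s. h (ginv s))"
    by (simp add: ennreal_indicator)
  also have "\<dots> = (LINT s:{g c..<g d}|lborel. h (ginv s))"
    unfolding set_lebesgue_integral_def using h by (subst integral_density) auto
  finally show ?thesis .
qed

end

section \<open>Monomials in the variable \<open>g\<close>\<close>

lemma bounded_interval_integrable:
  fixes f :: "real \<Rightarrow> real" and u v :: real
  assumes "f \<in> borel_measurable borel" "\<And>s. \<bar>f s\<bar> \<le> C"
  shows "interval_lebesgue_integrable lborel u v f"
proof -
  have "integrable lborel (\<lambda>s. indicator {x<..<y} s *\<^sub>R f s)" for x y
    using assms emeasure_bounded_finite[of "{x<..<y}"]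
    by (intro integrableI_bounded_set_indicator[where B = C]) simp_all
  then show ?thesis
    unfolding interval_lebesgue_integrable_def set_integrable_def by simp
qed

lemma bounded_interval_integral_diff:
  fixes f :: "real \<Rightarrow> real" and u v w :: real
  assumes "f \<in> borel_measurable borel" "\<And>s. \<bar>f s\<bar> \<le> C"
  shows "(LBINT s=w..v. f s) - (LBINT s=w..u. f s) = (LBINT s=u..v. f s)"
proof -
  have "(LBINT s=w..u. f s) + (LBINT s=u..v. f s) = (LBINT s=w..v. f s)"
    using bounded_interval_integrable[OF assms] by (intro interval_integral_sum) (simp flip: ereal_min ereal_max)
  then show ?thesis by simp
qed

lemma bounded_interval_integral_abs_le:
  fixes f :: "real \<Rightarrow> real" and u v :: real
  assumes "f \<in> borel_measurable borel" "\<And>s. \<bar>f s\<bar> \<le> C"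
  shows "\<bar>LBINT s=u..v. f s\<bar> \<le> C * \<bar>v - u\<bar>"
proof (induction u v rule: linorder_wlog)
  case (le u v)
  have "\<bar>LBINT s=u..v. f s\<bar> \<le> (LBINT s=u..v. \<bar>f s\<bar>)"
    using interval_integral_norm[OF bounded_interval_integrable[OF assms], of u v] le by simp
  also have "\<dots> \<le> (LBINT s=u..v. C)"
    unfolding interval_lebesgue_integral_le_eq[of "ereal u" "ereal v", simplified, OF le]
    using le bounded_interval_integrable[of "\<lambda>s. \<bar>f s\<bar>" C u v] bounded_interval_integrable[of "\<lambda>s. C" "\<bar>C\<bar>" u v] assms
    by (intro set_integral_mono) (auto simp: interval_lebesgue_integrable_def)
  also have "\<dots> = C * \<bar>v - u\<bar>" using le by simp
  finally show ?case .
next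
  case (sym u v)
  then show ?case
    using interval_integral_endpoints_reverse[of v u f] by (simp add: abs_minus_commute)
qed

text \<open>The integrand may be discontinuous, so the argument is measure-theoretic: a zero
  integral would make the open interval a null set.\<close>

lemma interval_integral_pos:
  fixes f :: "real \<Rightarrow> real" and u v :: real
  assumes "u < v" "interval_lebesgue_integrable lborel u v f" "\<And>s. u < s \<Longrightarrow> s < v \<Longrightarrow> 0 < f s"
  shows "0 < (LBINT s=u..v. f s)"
proof -
  let ?f = "\<lambda>s. indicator {u<..<v} s *\<^sub>R f s"
  have eq: "(LBINT s=u..v. f s) = integral\<^sup>L lborel ?f"
    using assms(1) by (simp add: interval_integral_Ioo set_lebesgue_integral_def)
  have int: "integrable lborel ?f"
    using assms(1,2) by (simp add: interval_lebesgue_integrable_def set_integrable_def)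
  have nonneg: "0 \<le> ?f s" for s
    using assms(3)[of s] by (auto simp: indicator_def)
  have "integral\<^sup>L lborel ?f \<noteq> 0"
  proof
    assume "integral\<^sup>L lborel ?f = 0"
    then have "AE s in lborel. ?f s = 0"
      using integral_nonneg_eq_0_iff_AE[OF int] nonneg by simp
    then have "AE s in lborel. s \<notin> {u<..<v}"
      by (rule AE_mp) (use assms(3) in \<open>force intro!: AE_I2 simp: indicator_def\<close>)
    then have "emeasure lborel {u<..<v} = 0"
      by (subst (asm) AE_iff_measurable[of "{u<..<v}"]) auto
    with assms(1) show False by simp
  qed
  moreover have "0 \<le> integral\<^sup>L lborel ?f"
    using nonneg by (rule Bochner_Integration.integral_nonneg)
  ultimately show ?thesis unfolding eq by simp
qed

text \<open>For \<open>\<gamma>\<close> the identity these are the powers of \<open>u - w\<close>.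
  With \<open>\<gamma> = g \<circ> ginv\<close> the integrand is frozen across each jump of
  \<open>g\<close>.\<close>

primrec iterated_monomial :: "(real \<Rightarrow> real) \<Rightarrow> real \<Rightarrow> nat \<Rightarrow> real \<Rightarrow> real" where
  "iterated_monomial \<gamma> w 0 = (\<lambda>u. 1)"
| "iterated_monomial \<gamma> w (Suc n) =
     (\<lambda>u. real (Suc n) * (LBINT s=w..u. iterated_monomial \<gamma> w n (\<gamma> s)))"

locale bounded_mono =
  fixes \<gamma> :: "real \<Rightarrow> real"
  assumes mono: "mono \<gamma>" and bounded: "bounded (range \<gamma>)"
begin

text \<open>A continuous \<open>h\<close> may be unbounded on the whole real axis, but only its
  values on the compact closure of the range of \<open>\<gamma>\<close> enter.\<close>

lemma bounded_comp:
  assumes "continuous_on UNIV (h :: real \<Rightarrow> real)"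
  obtains C where "\<And>s. \<bar>h (\<gamma> s)\<bar> \<le> C"
proof -
  have "compact (closure (range \<gamma>))"
    using bounded by (simp add: compact_closure)
  then have "bounded (h ` closure (range \<gamma>))"
    by (intro compact_imp_bounded compact_continuous_image continuous_on_subset[OF assms]) auto
  then obtain C where "\<And>x. x \<in> closure (range \<gamma>) \<Longrightarrow> \<bar>h x\<bar> \<le> C"
    by (auto simp: bounded_iff)
  with that closure_subset show ?thesis by blast
qed

lemma measurable_comp:
  assumes "continuous_on UNIV (h :: real \<Rightarrow> real)"
  shows "(\<lambda>s. h (\<gamma> s)) \<in> borel_measurable borel"
  using borel_measurable_continuous_onI[OF assms] borel_measurable_mono[OF mono]
  by measurable

lemma integrable_comp:
  assumes "continuous_on UNIV (h :: real \<Rightarrow> real)"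
  shows "interval_lebesgue_integrable lborel (ereal u) (ereal v) (\<lambda>s. h (\<gamma> s))"
  using bounded_comp[OF assms] measurable_comp[OF assms] bounded_interval_integrable by metis

text \<open>The integral of a bounded function is Lipschitz in its endpoint, even though
  \<open>\<gamma>\<close> may jump.\<close>

lemma continuous_on_iterated_monomial: "continuous_on UNIV (iterated_monomial \<gamma> w n)"
proof (induction n)
  case (Suc n)
  obtain C where C: "\<And>s. \<bar>iterated_monomial \<gamma> w n (\<gamma> s)\<bar> \<le> C"
    using bounded_comp[OF Suc] by blast
  let ?I = "\<lambda>u. LBINT s=w..u. iterated_monomial \<gamma> w n (\<gamma> s)"
  have "C-lipschitz_on UNIV ?I"
  proof (rule lipschitz_onI)
    show "dist (?I x) (?I y) \<le> C * dist x y" for x y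
      using bounded_interval_integral_diff[OF measurable_comp[OF Suc] C, of w x y]
        bounded_interval_integral_abs_le[OF measurable_comp[OF Suc] C, of y x]
      by (simp add: dist_real_def)
    show "0 \<le> C" using C[of 0] by linarith
  qed
  then show ?case
    using lipschitz_on_continuous_on by (auto intro!: continuous_intros)
qed simp

lemma iterated_monomial_diff:
  "iterated_monomial \<gamma> w (Suc n) v - iterated_monomial \<gamma> w (Suc n) u =
    real (Suc n) * (LBINT s=u..v. iterated_monomial \<gamma> w n (\<gamma> s))"
proof -
  obtain C where C: "\<And>s. \<bar>iterated_monomial \<gamma> w n (\<gamma> s)\<bar> \<le> C"
    using bounded_comp[OF continuous_on_iterated_monomial] by blast
  show ?thesis
    using bounded_interval_integral_diff[OF measurable_comp[OF continuous_on_iterated_monomial] C, of w v u]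
    by (simp add: algebra_simps)
qed

lemma interval_integral_combination:
  fixes u v :: real and c :: "nat \<Rightarrow> real"
  shows "(LBINT s=u..v. combination (iterated_monomial \<gamma> w) n c (\<gamma> s)) =
    (\<Sum>k\<le>n. c k * (LBINT s=u..v. iterated_monomial \<gamma> w k (\<gamma> s)))"
proof (induction n)
  case 0
  show ?case by (simp add: combination_def)
next
  case (Suc n)
  let ?\<phi> = "iterated_monomial \<gamma> w"
  have "(LBINT s=u..v. combination ?\<phi> (Suc n) c (\<gamma> s)) =
      (LBINT s=u..v. combination ?\<phi> n c (\<gamma> s) + c (Suc n) * ?\<phi> (Suc n) (\<gamma> s))"
    by (simp add: combination_def)
  also have "\<dots> = (LBINT s=u..v. combination ?\<phi> n c (\<gamma> s)) + (LBINT s=u..v. c (Suc n) * ?\<phi> (Suc n) (\<gamma> s))"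
    by (intro interval_lebesgue_integral_add integrable_comp continuous_on_combination
        continuous_on_mult_left continuous_on_iterated_monomial)
  finally show ?case
    unfolding Suc.IH interval_lebesgue_integral_mult_right by simp
qed

text \<open>The increment of a combination is the integral of its derivative along
  \<open>\<gamma>\<close>. Since \<open>\<gamma>\<close> maps the open interval into
  \<open>K\<close> and between \<open>u\<close> and \<open>v\<close>, a derivative negative at all
  those points of \<open>K\<close> would give a negative increment.\<close>

lemma rolle_system_iterated_monomial:
  assumes K: "\<And>u v s. \<lbrakk>u \<in> K; v \<in> K; u < s; s < v\<rbrakk> \<Longrightarrow> \<gamma> s \<in> K \<and> u \<le> \<gamma> s \<and> \<gamma> s < v"
  shows "rolle_system (iterated_monomial \<gamma> w) K"
proof
  let ?\<phi> = "iterated_monomial \<gamma> w"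
  show "?\<phi> 0 u = 1" for u by simp
  fix u v :: real and n and c :: "nat \<Rightarrow> real"
  assume uv: "u \<in> K" "v \<in> K" "u < v"
    and le: "combination ?\<phi> (Suc n) c u \<le> combination ?\<phi> (Suc n) c v"
  let ?p = "combination ?\<phi> n (\<lambda>k. real (Suc k) * c (Suc k))"
  have cont: "continuous_on UNIV ?p"
    by (rule continuous_on_combination) (rule continuous_on_iterated_monomial)
  have "combination ?\<phi> (Suc n) c v - combination ?\<phi> (Suc n) c u =
      (\<Sum>k\<le>Suc n. c k * (?\<phi> k v - ?\<phi> k u))"
    by (simp add: combination_def sum_subtractf right_diff_distrib)
  \<comment> \<open>The constant basis function has no increment, so the sum starts at index
    1.\<close>
  also have "\<dots> = (\<Sum>k\<le>n. c (Suc k) * (?\<phi> (Suc k) v - ?\<phi> (Suc k) u))"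
    by (subst sum.atMost_Suc_shift) simp
  also have "\<dots> = (LBINT s=u..v. ?p (\<gamma> s))"
    unfolding interval_integral_combination iterated_monomial_diff by (simp add: mult_ac)
  finally have diff: "combination ?\<phi> (Suc n) c v - combination ?\<phi> (Suc n) c u = (LBINT s=u..v. ?p (\<gamma> s))" .
  show "\<exists>z\<in>K. u \<le> z \<and> z < v \<and> 0 \<le> ?p z"
  proof (rule ccontr)
    assume "\<not> ?thesis"
    then have "0 < - ?p (\<gamma> s)" if "u < s" "s < v" for s
      using K[OF uv(1,2) that] by force
    then have "0 < (LBINT s=u..v. - ?p (\<gamma> s))"
      using uv(3) integrable_comp[of "\<lambda>x. - ?p x" u v] cont
      by (intro interval_integral_pos) (auto intro: continuous_intros)
    also have "(LBINT s=u..v. - ?p (\<gamma> s)) = - (LBINT s=u..v. ?p (\<gamma> s))"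
      using interval_lebesgue_integral_mult_right[of lborel u v "-1" "\<lambda>s. ?p (\<gamma> s)"] by simp
    finally show False using le diff by simp
  qed
qed

end

section \<open>Stieltjes monomials as functions of \<open>g\<close>\<close>

context derivator_on
begin

sublocale bounded_mono "\<lambda>s. g (ginv s)"
proof
  show "mono (\<lambda>s. g (ginv s))"
    using mono_ginv by (auto simp: mono_def intro: g_mono)
  show "bounded (range (\<lambda>s. g (ginv s)))"
    using ginv_mem by (intro bounded_subset[OF bounded_closed_interval[of "g A" "g B"]])
      (auto intro!: g_mono)
qed

text \<open>Each step of the recursion is one change of variables; for \<open>x < x0\<close> the
  sign convention matches reversal of the endpoints.\<close>

lemma stieltjes_monomial_eq:
  assumes "x0 \<in> {A..B}" "x \<in> {A..B}"
  shows "stieltjes_monomial g x0 n x = iterated_monomial (\<lambda>s. g (ginv s)) (g x0) n (g x)"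
  using assms(2)
proof (induction n arbitrary: x)
  case (Suc n)
  let ?\<phi> = "iterated_monomial (\<lambda>s. g (ginv s)) (g x0) n"
  have meas: "(\<lambda>t. ?\<phi> (g t)) \<in> borel_measurable borel"
  proof -
    have "g \<in> borel_measurable borel" 
      using derivator by (intro borel_measurable_mono) (simp add: derivator_def)
    then show ?thesis
      using borel_measurable_continuous_onI[OF continuous_on_iterated_monomial] by measurable
  qed
  have int: "(LINT t:{c..<d}|stieltjes_measure g. stieltjes_monomial g x0 n t) =
      (LBINT s=g c..g d. ?\<phi> (g (ginv s)))" if "A \<le> c" "c \<le> d" "d \<le> B" for c d
  proof -
    \<comment> \<open>The induction hypothesis is confined to \<open>{A..B}\<close>, which contains
      the domain of integration; the replacement integrand is Borel measurable everywhere, as the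
      substitution requires.\<close>
    have "(LINT t:{c..<d}|stieltjes_measure g. stieltjes_monomial g x0 n t) =
        (LINT t:{c..<d}|stieltjes_measure g. ?\<phi> (g t))"
      using Suc.IH that by (intro set_lebesgue_integral_cong) auto
    also have "\<dots> = (LINT s:{g c..<g d}|lborel. ?\<phi> (g (ginv s)))"
      using that meas by (rule stieltjes_set_integral)
    finally show ?thesis
      using g_mono[OF that(2)] by (simp add: interval_integral_Ico)
  qed
  have "stieltjes_integral g x0 x (stieltjes_monomial g x0 n) = (LBINT s=g x0..g x. ?\<phi> (g (ginv s)))"
  proof (cases "x0 \<le> x")
    case True
    then show ?thesis
      using int[of x0 x] assms(1) Suc.prems by (simp add: stieltjes_integral_def)
  next
    case False
    then show ?thesis
      using int[of x x0] assms(1) Suc.prems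
      unfolding interval_integral_endpoints_reverse[of "g x0" "g x"]
      by (simp add: stieltjes_integral_def)
  qed
  then show ?case by simp
qed simp

text \<open>Supplies the hypothesis of the Rolle lemma for the closure of the image. Points of
  \<open>{a..b}\<close> whose values lie below and above \<open>s\<close> enclose
  \<open>ginv s\<close>, so it belongs to \<open>{a..b}\<close>.\<close>

lemma g_ginv_between:
  assumes ab: "A \<le> a" "b \<le> B"
    and uv: "u \<in> closure (g ` {a..b})" "v \<in> closure (g ` {a..b})" "u < s" "s < v"
  shows "g (ginv s) \<in> closure (g ` {a..b}) \<and> u \<le> g (ginv s) \<and> g (ginv s) < v"
proof -
  have near: "\<exists>t\<in>{a..b}. dist (g t) x < e" if "x \<in> closure (g ` {a..b})" "0 < e" for x e
    using that unfolding closure_approachable by auto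
  obtain t where t: "t \<in> {a..b}" "g t < s"
    using near[OF uv(1), of "s - u"] uv(3) by (auto simp: dist_real_def)
  obtain t' where t': "t' \<in> {a..b}" "s < g t'"
    using near[OF uv(2), of "v - s"] uv(4) by (auto simp: dist_real_def)
  have gA: "g A \<le> s"
    using t ab g_mono[of A t] by auto
  have below: "r \<le> ginv s" if "r \<in> {a..b}" "g r < s" for r
    using le_ginv_iff[OF _ gA, of r] that ab by auto
  have "ginv s < t'"
    using le_ginv_iff[OF _ gA, of t'] t' ab by auto
  then have "ginv s \<in> {a..b}"
    using below[OF t] t(1) t'(1) by auto
  then have "g (ginv s) \<in> closure (g ` {a..b})"
    using closure_subset by fast
  \<comment> \<open>The point \<open>u\<close> may be only a limit of values of \<open>g\<close>, so
    it is approximated by values \<open>g r\<close> below \<open>s\<close>.\<close>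
  moreover have "u \<le> g (ginv s)"
  proof (rule field_le_epsilon)
    fix e :: real assume "0 < e"
    then obtain r where r: "r \<in> {a..b}" "dist (g r) u < min e (s - u)"
      using near[OF uv(1), of "min e (s - u)"] uv(3) by auto
    then have "g r < s" by (auto simp: dist_real_def)
    then have "g r \<le> g (ginv s)"
      using below[OF r(1)] by (intro g_mono)
    with r(2) show "u \<le> g (ginv s) + e" by (auto simp: dist_real_def)
  qed
  moreover have "g (ginv s) < v"
    using g_ginv_le[OF gA] uv(4) by simp
  ultimately show ?thesis by blast
qed

end

section \<open>Transfer to uniformly g-continuous functions\<close>

lemma unique_best_approximation:
  fixes f :: "real \<Rightarrow> 'a::{real_normed_field, euclidean_space}"
  assumes "derivator g" "a < b" "uniformly_g_continuous g a b f"
  shows "\<exists>!p. p \<in> stieltjes_polynomials g x0 n a b \<and>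
    sup_norm a b (\<lambda>x. f x - p x) =
      (INF q\<in>stieltjes_polynomials g x0 n a b. sup_norm a b (\<lambda>x. f x - q x))"
proof -
  \<comment> \<open>The base point may lie outside \<open>{a..b}\<close>, so the substitution is set
    up on the hull.\<close>
  interpret derivator_on g "min a x0" "max b x0"
    using assms by unfold_locales auto
  define \<phi> where "\<phi> = iterated_monomial (\<lambda>s. g (ginv s)) (g x0)"
  let ?X = "g ` {a..b}"
  let ?K = "closure ?X"
  have monomial: "stieltjes_monomial g x0 k x = \<phi> k (g x)" if "x \<in> {a..b}" for k x
    unfolding \<phi>_def using that assms(2) by (intro stieltjes_monomial_eq) auto
  interpret rolle_system \<phi> ?K
    unfolding \<phi>_def by (intro rolle_system_iterated_monomial g_ginv_between) auto
  have "?X \<subseteq> {g a..g b}"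
    using g_mono by auto
  then have "bounded ?X"
    using bounded_subset bounded_closed_interval by blast
  interpret haar_system \<phi> ?K
  proof
    show "compact ?K" using \<open>bounded ?X\<close> by (simp add: compact_closure)
    show "?K \<noteq> {}" using assms(2) by auto
    show "continuous_on ?K (\<phi> k)" for k
      unfolding \<phi>_def by (rule continuous_on_subset[OF continuous_on_iterated_monomial]) auto
  qed (rule zero_set_imp_zero)
  have f_cont: "\<exists>\<delta>>0. \<forall>x\<in>{a..b}. \<forall>y\<in>{a..b}. \<bar>g x - g y\<bar> < \<delta> \<longrightarrow> norm (f x - f y) < \<epsilon>"
    if "0 < \<epsilon>" for \<epsilon>
    using assms(3) that by (auto simp: uniformly_g_continuous_def)
  have f_eq: "f x = f y" if "x \<in> {a..b}" "y \<in> {a..b}" "g x = g y" for x y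
  proof -
    have "norm (f x - f y) \<le> 0"
    proof (rule field_le_epsilon)
      fix e :: real assume "0 < e"
      with f_cont[of e] that show "norm (f x - f y) \<le> 0 + e" by force
    qed
    then show ?thesis by simp
  qed
  \<comment> \<open>The choice of preimage is immaterial, as \<open>f\<close> is constant on the
    level sets of \<open>g\<close>.\<close>
  define F0 where "F0 u = f (SOME x. x \<in> {a..b} \<and> g x = u)" for u
  have F0: "F0 (g x) = f x" if "x \<in> {a..b}" for x
  proof -
    have "(SOME y. y \<in> {a..b} \<and> g y = g x) \<in> {a..b} \<and> g (SOME y. y \<in> {a..b} \<and> g y = g x) = g x"
      using that by (intro someI[of "\<lambda>y. y \<in> {a..b} \<and> g y = g x"]) auto
    then show ?thesis using f_eq that unfolding F0_def by blast
  qed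
  \<comment> \<open>Uniform \<open>g\<close>-continuity of \<open>f\<close> is precisely this, and
    it allows extension to the closure.\<close>
  have "uniformly_continuous_on ?X F0"
    unfolding uniformly_continuous_on_def
  proof (intro allI impI)
    fix e :: real assume "0 < e"
    then obtain d where "0 < d" "\<forall>x\<in>{a..b}. \<forall>y\<in>{a..b}. \<bar>g x - g y\<bar> < d \<longrightarrow> norm (f x - f y) < e"
      using f_cont by blast
    then show "\<exists>d>0. \<forall>x\<in>?X. \<forall>x'\<in>?X. dist x' x < d \<longrightarrow> dist (F0 x') (F0 x) < e"
      by (intro exI[of _ d]) (auto simp: F0 dist_norm)
  qed
  then obtain F where "uniformly_continuous_on ?K F" and FX: "\<And>u. u \<in> ?X \<Longrightarrow> F0 u = F u"
    by (rule uniformly_continuous_on_extension_on_closure) blast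
  then have F: "continuous_on ?K F"
    by (simp add: uniformly_continuous_imp_continuous)
  have Ff: "F (g x) = f x" if "x \<in> {a..b}" for x
    using FX[of "g x"] F0[OF that] that by auto
  have gK: "g x \<in> ?K" if "x \<in> {a..b}" for x
    using that closure_subset[of ?X] by auto
  define P where "P c = restrict (\<lambda>x. \<Sum>k\<le>n. c k * of_real (stieltjes_monomial g x0 k x)) {a..b}"
    for c :: "nat \<Rightarrow> 'a"
  have P: "P c x = combination \<phi> n c (g x)" if "x \<in> {a..b}" for c x
    using that by (simp add: P_def combination_def monomial)
  have polys: "stieltjes_polynomials g x0 n a b = range P"
    by (auto simp: stieltjes_polynomials_def P_def)
  \<comment> \<open>The image of \<open>g\<close> is dense in its closure, so by continuity both
    suprema of the error agree.\<close>
  have dev: "sup_norm a b (\<lambda>x. f x - P c x) = deviation F n c" for c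
  proof -
    have "sup_norm a b (\<lambda>x. f x - P c x) = (SUP x\<in>{a..b}. norm (F (g x) - combination \<phi> n c (g x)))"
      unfolding sup_norm_def by (intro SUP_cong) (simp_all add: P Ff)
    also have "\<dots> = deviation F n c" (is "?s = _")
    proof (rule antisym)
      have le: "norm (F (g x) - combination \<phi> n c (g x)) \<le> deviation F n c" if "x \<in> {a..b}" for x
        using gK[OF that] by (rule deviation_attained(2)[OF F])
      then show "?s \<le> deviation F n c"
        using assms(2) by (intro cSUP_least) auto
      have "norm (F u - combination \<phi> n c u) \<le> ?s" if "u \<in> ?K" for u
      proof (rule continuous_le_on_closure[OF _ that])
        show "continuous_on ?K (\<lambda>u. norm (F u - combination \<phi> n c u))"
          by (intro continuous_intros F continuous_on_basis_combination)
        have "bdd_above ((\<lambda>x. norm (F (g x) - combination \<phi> n c (g x))) ` {a..b})"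
          using le by (rule bdd_aboveI2)
        then show "norm (F x - combination \<phi> n c x) \<le> ?s" if "x \<in> ?X" for x
          using that cSUP_upper[of _ "{a..b}"] by fastforce
      qed
      then show "deviation F n c \<le> ?s"
        using deviation_attained(1)[OF F, of n c] by auto
    qed
    finally show ?thesis .
  qed
  define d where "d = (INF q\<in>range P. sup_norm a b (\<lambda>x. f x - q x))"
  have best_iff: "deviation F n c = d \<longleftrightarrow> (\<forall>c'. deviation F n c \<le> deviation F n c')" for c
  proof
    have bdd: "bdd_below (range (deviation F n))"
      using deviation_nonneg[OF F] by (intro bdd_belowI[of _ 0]) auto
    have d: "d = (INF c. deviation F n c)"
      by (simp add: d_def image_image dev)
    show "\<forall>c'. deviation F n c \<le> deviation F n c'" if "deviation F n c = d"
      unfolding that unfolding d by (intro allI cINF_lower bdd) auto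
    show "deviation F n c = d" if "\<forall>c'. deviation F n c \<le> deviation F n c'"
      unfolding d using that bdd by (intro antisym cINF_greatest cINF_lower) auto
  qed
  show ?thesis
    unfolding polys d_def[symmetric]
  proof (rule ex_ex1I)
    obtain c where "\<forall>c'. deviation F n c \<le> deviation F n c'"
      using best_approximation_exists[OF F] by blast
    then show "\<exists>p. p \<in> range P \<and> sup_norm a b (\<lambda>x. f x - p x) = d"
      using best_iff dev by (intro exI[of _ "P c"]) auto
  next
    fix p q
    assume "p \<in> range P \<and> sup_norm a b (\<lambda>x. f x - p x) = d"
      and "q \<in> range P \<and> sup_norm a b (\<lambda>x. f x - q x) = d"
    then obtain c1 c2 where c: "p = P c1" "q = P c2" "deviation F n c1 = d" "deviation F n c2 = d"
      using dev by auto
    have "combination \<phi> n c1 u = combination \<phi> n c2 u" if "u \<in> ?K" for u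
      using that c(3,4) best_iff by (intro best_approximation_unique[OF F]) auto
    then have "P c1 x = P c2 x" if "x \<in> {a..b}" for x
      using that gK[OF that] by (simp add: P)
    \<comment> \<open>Both restrictions take the same default value there, which yields equality as
      functions.\<close>
    moreover have "P c1 x = P c2 x" if "x \<notin> {a..b}" for x
      using that by (simp only: P_def restrict_def if_False)
    ultimately show "p = q" unfolding c by blast
  qed
qed

theorem corollary6p10:
  fixes g :: "real \<Rightarrow> real" and a b x0 :: real and n :: nat
  assumes "derivator g" and "a < b"
  shows "(\<forall>f :: real \<Rightarrow> real. uniformly_g_continuous g a b f \<longrightarrow>
            (\<exists>!p. p \<in> stieltjes_polynomials g x0 n a b \<and>
                  sup_norm a b (\<lambda>x. f x - p x) =
                    (INF q\<in>stieltjes_polynomials g x0 n a b. sup_norm a b (\<lambda>x. f x - q x)))) \<and>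
         (\<forall>f :: real \<Rightarrow> complex. uniformly_g_continuous g a b f \<longrightarrow>
            (\<exists>!p. p \<in> stieltjes_polynomials g x0 n a b \<and>
                  sup_norm a b (\<lambda>x. f x - p x) =
                    (INF q\<in>stieltjes_polynomials g x0 n a b. sup_norm a b (\<lambda>x. f x - q x))))"
  \<comment> \<open>The real and complex numbers are both Euclidean normed fields, so one lemma
    serves both conjuncts.\<close>
  by (intro conjI allI impI unique_best_approximation assms)

end
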